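(* Let $j$ and $k$ be positive integers with $j\neq k$. Then there exists a real quasi-positive matrix $T$ such that $\operatorname{Tr}\left(T^k(T^* )^j\right)<0$.
   Context: A square matrix is called quasi-positive if it is diagonalizable and all its eigenvalues are positive real numbers. $T^*$ denotes the conjugate transpose of $T$ (the transpose, since $T$ is real). *)

theory Defs
  imports Complex_Main "Jordan_Normal_Form.Char_Poly"
begin

definition diagonalizable :: "'a :: field mat \<Rightarrow> bool" where
  "diagonalizable A \<longleftrightarrow> (\<exists>D. diagonal_mat D \<and> similar_mat A D)"

(* Eigenvalues range over the complex numbers; a real matrix is tested through its
   complexification, so non-real eigenvalues are not overlooked. *)
definition quasi_positive :: "complex mat \<Rightarrow> bool" where
  "quasi_positive A \<longleftrightarrow>
     square_mat A \<and> diagonalizable A \<and> (\<forall>e. eigenvalue A e \<longrightarrow> e \<in> \<real> \<and> Re e > 0)"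

definition mat_trace :: "'a :: comm_monoid_add mat \<Rightarrow> 'a" where
  "mat_trace A = (\<Sum>i<dim_row A. A $$ (i, i))"

end

theory Submission
  imports Defs
begin

text \<open>
  The idea is to work with \<open>3 \<times> 3\<close> upper triangular matrices with diagonal \<open>1, 2, 4\<close>: distinct
  positive eigenvalues give quasi-positivity for free, while the entries above the diagonal can be
  chosen at will. Since \<open>Tr(A B\<^sup>T)\<close> is the sum of the products of corresponding entries of \<open>A\<close> and
  \<open>B\<close>, it is enough that the top right corners of \<open>T\<^sup>k\<close> and \<open>T\<^sup>j\<close> have opposite signs and dominate
  all other entries. (For triangular \<open>2 \<times> 2\<close> matrices this is impossible: with positive eigenvalues, the
  off-diagonal entry of a power is a positive multiple of that of the matrix.)

  Conjugating \<open>diag(1, 2, 4)\<close> by a unipotent matrix with parameters \<open>x\<close> next to the diagonal and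
  \<open>z\<close> in the corner gives \<open>T\<^sup>k\<close> in closed form, as \<open>geom_mat x z (2\<^sup>k)\<close>. Its corner is
  \<open>(2\<^sup>k - 1) (z (2\<^sup>k + 1) - x\<^sup>2)\<close>, whose sign changes when \<open>2\<^sup>k + 1\<close> crosses \<open>x\<^sup>2 / z\<close>. As
  \<open>j \<noteq> k\<close>, the ratio \<open>x\<^sup>2 / z\<close> can be fixed strictly between \<open>2\<^sup>j + 1\<close> and \<open>2\<^sup>k + 1\<close>. Then the
  corners contribute a negative multiple of \<open>x\<^sup>4\<close> to the trace, all other entries contribute at
  most order \<open>x\<^sup>2\<close>, and a large \<open>x\<close> makes the trace negative.
\<close>

text \<open>
  This is \<open>P diag(1, p, p\<^sup>2) P\<^sup>-\<^sup>1\<close>, where \<open>P\<close> is the unipotent upper triangular matrix with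
  entries \<open>x, x\<close> on the superdiagonal and \<open>z\<close> in the corner. Only \<open>p\<close> changes when powers are taken.
\<close>
definition geom_mat :: "'a \<Rightarrow> 'a \<Rightarrow> 'a \<Rightarrow> 'a :: comm_ring_1 mat" where
  "geom_mat x z p = mat_of_rows_list 3
     [[1, x * (p - 1), (p - 1) * (z * (p + 1) - x\<^sup>2)],
      [0, p, x * p * (p - 1)],
      [0, 0, p\<^sup>2]]"

lemma less_3_cases: "(i::nat) < 3 \<longleftrightarrow> i = 0 \<or> i = 1 \<or> i = 2"
  by auto

lemma sum_upto_3: "(\<Sum>i = 0..<3. f i) = f 0 + f 1 + f (2::nat)"
  by (simp add: numeral_3_eq_3 numeral_2_eq_2)

lemma eq_mat_3I:
  assumes "A \<in> carrier_mat 3 3" and "B \<in> carrier_mat 3 3"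
    and "\<And>i j. i \<in> {0, 1, 2} \<Longrightarrow> j \<in> {0, 1, 2} \<Longrightarrow> A $$ (i, j) = B $$ (i, j)"
  shows "A = B"
  using assms by (intro eq_matI) (auto simp: less_3_cases)

lemma geom_mat_carrier [simp]: "geom_mat x z p \<in> carrier_mat 3 3"
  by (simp add: geom_mat_def mat_of_rows_list_def numeral_3_eq_3)

lemma geom_mat_dim [simp]: "dim_row (geom_mat x z p) = 3" "dim_col (geom_mat x z p) = 3"
  using geom_mat_carrier by blast+

lemma index_mult_3:
  assumes "A \<in> carrier_mat 3 3" "B \<in> carrier_mat 3 3" "i < 3" "j < 3"
  shows "(A * B) $$ (i, j) = A $$ (i, 0) * B $$ (0, j) + A $$ (i, 1) * B $$ (1, j) + A $$ (i, 2) * B $$ (2, j)"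
  using assms by (simp add: scalar_prod_def sum_upto_3)

lemma geom_mat_index:
  "geom_mat x z p $$ (0, 0) = 1"
  "geom_mat x z p $$ (0, Suc 0) = x * (p - 1)"
  "geom_mat x z p $$ (0, 2) = (p - 1) * (z * (p + 1) - x\<^sup>2)"
  "geom_mat x z p $$ (Suc 0, 0) = 0"
  "geom_mat x z p $$ (Suc 0, Suc 0) = p"
  "geom_mat x z p $$ (Suc 0, 2) = x * p * (p - 1)"
  "geom_mat x z p $$ (2, 0) = 0"
  "geom_mat x z p $$ (2, Suc 0) = 0"
  "geom_mat x z p $$ (2, 2) = p\<^sup>2"
  by (simp_all add: geom_mat_def mat_of_rows_list_def numeral_3_eq_3 numeral_2_eq_2)

text \<open>
  The conjugating matrix does not depend on \<open>p\<close>, so \<open>p \<mapsto> geom_mat x z p\<close> is multiplicative, as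
  \<open>p \<mapsto> diag(1, p, p\<^sup>2)\<close> is. This turns all powers into members of the same family.
\<close>
lemma geom_mat_mult: "geom_mat x z p * geom_mat x z q = geom_mat x z (p * q)"
  by (rule eq_mat_3I)
     (auto simp: index_mult_3 geom_mat_index algebra_simps power2_eq_square
        simp del: index_mult_mat(1) intro!: mult_carrier_mat[of _ 3 3])

lemma geom_mat_1: "geom_mat x z 1 = 1\<^sub>m 3"
  by (rule eq_mat_3I) (auto simp: geom_mat_index)

lemma geom_mat_pow: "geom_mat x z p ^\<^sub>m k = geom_mat x z (p ^ k)"
proof (induction k)
  case (Suc k)
  then show ?case by (simp add: geom_mat_mult mult.commute)
qed (simp add: geom_mat_1)

lemma geom_mat_hom:
  "map_mat complex_of_real (geom_mat x z p) = geom_mat (of_real x) (of_real z) (of_real p)"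
  by (rule eq_mat_3I) (auto simp: geom_mat_index)

definition unip_mat :: "'a \<Rightarrow> 'a \<Rightarrow> 'a :: comm_ring_1 mat" where
  "unip_mat x z = mat_of_rows_list 3 [[1, x, z], [0, 1, x], [0, 0, 1]]"

lemma unip_mat_carrier [simp]: "unip_mat x z \<in> carrier_mat 3 3"
  by (simp add: unip_mat_def mat_of_rows_list_def numeral_3_eq_3)

lemma unip_mat_index:
  "unip_mat x z $$ (0, 0) = 1" "unip_mat x z $$ (0, Suc 0) = x" "unip_mat x z $$ (0, 2) = z"
  "unip_mat x z $$ (Suc 0, 0) = 0" "unip_mat x z $$ (Suc 0, Suc 0) = 1" "unip_mat x z $$ (Suc 0, 2) = x"
  "unip_mat x z $$ (2, 0) = 0" "unip_mat x z $$ (2, Suc 0) = 0" "unip_mat x z $$ (2, 2) = 1"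
  by (simp_all add: unip_mat_def mat_of_rows_list_def numeral_3_eq_3 numeral_2_eq_2)

lemma unip_mat_inverse: "unip_mat x z * unip_mat (-x) (x\<^sup>2 - z) = 1\<^sub>m 3"
  by (rule eq_mat_3I) (auto simp: index_mult_3 unip_mat_index power2_eq_square
        simp del: index_mult_mat(1) intro!: mult_carrier_mat[of _ 3 3])

lemma geom_mat_diagonalizable: "diagonalizable (geom_mat x z p)"
proof -
  define D where "D = geom_mat 0 0 p"
  have D: "D \<in> carrier_mat 3 3" by (simp add: D_def)
  have "diagonal_mat D"
    by (auto simp: diagonal_mat_def D_def less_3_cases geom_mat_index)
  \<comment> \<open>The product on the left only scales the columns of the unipotent matrix by \<open>1, p, p\<^sup>2\<close>.\<close>
  have eq: "geom_mat x z p = unip_mat x z * D * unip_mat (-x) (x\<^sup>2 - z)"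
  proof -
    define M where "M = unip_mat x z * D"
    have M: "M \<in> carrier_mat 3 3" by (simp add: M_def mult_carrier_mat[OF unip_mat_carrier D])
    have "M $$ (i, j) = unip_mat x z $$ (i, j) * p ^ j" if "i \<in> {0, 1, 2}" "j \<in> {0, 1, 2}" for i j
      using that by (auto simp: M_def index_mult_3 D) (auto simp: D_def geom_mat_index)
    then show ?thesis unfolding M_def[symmetric]
      by (intro eq_mat_3I)
         (use M in \<open>auto simp: index_mult_3 unip_mat_index geom_mat_index algebra_simps power2_eq_square
            simp del: index_mult_mat(1) intro!: mult_carrier_mat[of _ 3 3]\<close>)
  qed
  have inv: "unip_mat (-x) (x\<^sup>2 - z) * unip_mat x z = 1\<^sub>m 3"
    using unip_mat_inverse[of "-x" "x\<^sup>2 - z"] by simp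
  have "similar_mat (geom_mat x z p) D"
    by (rule similar_matI[OF _ unip_mat_inverse inv eq]) (simp add: D)
  with \<open>diagonal_mat D\<close> show ?thesis unfolding diagonalizable_def by blast
qed

lemma geom_mat_eigenvalue:
  fixes p :: "'a :: field"
  assumes "eigenvalue (geom_mat x z p) e"
  shows "e \<in> {1, p, p\<^sup>2}"
proof -
  have "upper_triangular (geom_mat x z p)"
    unfolding upper_triangular_def by (auto simp: less_3_cases less_2_cases_iff geom_mat_index)
  then have "char_poly (geom_mat x z p) = (\<Prod>a\<leftarrow>diag_mat (geom_mat x z p). [:- a, 1:])"
    by (rule char_poly_upper_triangular[OF geom_mat_carrier])
  moreover have "diag_mat (geom_mat x z p) = [1, p, p\<^sup>2]"
    by (simp add: diag_mat_def upt_rec geom_mat_index geom_mat_index(9)[unfolded numeral_2_eq_2]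
        power2_eq_square)
  ultimately have "poly (char_poly (geom_mat x z p)) e = (e - 1) * ((e - p) * (e - p\<^sup>2))"
    by (simp del: mult_pCons_left mult_pCons_right)
  then show ?thesis
    using assms by (simp add: eigenvalue_root_char_poly[OF geom_mat_carrier])
qed

lemma geom_mat_quasi_positive:
  assumes "p > 0"
  shows "quasi_positive (map_mat complex_of_real (geom_mat x z p))"
proof -
  have "e \<in> \<real> \<and> Re e > 0"
    if "eigenvalue (map_mat complex_of_real (geom_mat x z p)) e" for e
  proof -
    have "e \<in> {1, of_real p, (of_real p)\<^sup>2}"
      using that unfolding geom_mat_hom by (rule geom_mat_eigenvalue)
    then have "e \<in> of_real ` {1, p, p\<^sup>2}" by simp
    with assms show ?thesis by (auto simp del: of_real_power)
  qed
  then show ?thesis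
    by (simp add: quasi_positive_def geom_mat_hom geom_mat_diagonalizable)
qed

lemma transpose_geom_mat_pow:
  "transpose_mat (geom_mat x z p) ^\<^sub>m k = transpose_mat (geom_mat x z (p ^ k))"
proof (induction k)
  case (Suc k)
  then show ?case
    by (simp add: geom_mat_mult flip: transpose_mult[OF geom_mat_carrier geom_mat_carrier])
qed (simp add: geom_mat_1)

text \<open>
  The trace is the sum of the products of corresponding entries: first the diagonals, then the
  superdiagonals, then the two corners. Over the reals with \<open>p, q > 1\<close>, only the last summand can
  be negative.
\<close>
lemma mat_trace_geom_mat:
  "mat_trace (geom_mat x z p * transpose_mat (geom_mat x z q)) =
     1 + p * q + p\<^sup>2 * q\<^sup>2 + x\<^sup>2 * ((p - 1) * (q - 1) * (1 + p * q))
     + (p - 1) * (q - 1) * (z * (p + 1) - x\<^sup>2) * (z * (q + 1) - x\<^sup>2)"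
  by (simp add: mat_trace_def lessThan_atLeast0 sum_upto_3 index_mult_3 geom_mat_index
        del: index_mult_mat(1))
     (simp add: algebra_simps power2_eq_square)

lemma quadratic_dominates_at_square:
  fixes a b c :: real
  assumes "a \<ge> 0" "b \<ge> 0" "c > 0"
  shows "\<exists>x. a + b * x\<^sup>2 - c * (x\<^sup>2)\<^sup>2 < 0"
proof -
  \<comment> \<open>Since \<open>1 \<le> x \<le> x\<^sup>2\<close>, it suffices that \<open>x\<close> itself exceeds \<open>(a + b) / c\<close>.\<close>
  define x where "x = 1 + (a + b) / c"
  have "1 \<le> x" using assms by (simp add: x_def)
  then have sq: "x \<le> x\<^sup>2" "1 \<le> x\<^sup>2" by (auto simp: power2_eq_square mult_le_cancel_left1 intro: mult_ge1_I)
  have "a + b * x\<^sup>2 \<le> (a + b) * x\<^sup>2"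
    using mult_left_mono[OF sq(2) assms(1)] by (simp add: algebra_simps)
  also have "a + b < c * x"
    using assms by (simp add: x_def field_simps)
  then have "a + b < c * x\<^sup>2"
    using mult_left_mono[OF sq(1), of c] assms by linarith
  then have "(a + b) * x\<^sup>2 < c * (x\<^sup>2)\<^sup>2"
    using sq mult_strict_right_mono[of "a + b" "c * x\<^sup>2" "x\<^sup>2"]
    by (simp only: power2_eq_square[of "x\<^sup>2"] mult.assoc)
  finally show ?thesis by (intro exI[of _ x]) linarith
qed

text \<open>
  With \<open>z = w x\<^sup>2\<close> the corner factors become \<open>x\<^sup>2 (w (p + 1) - 1)\<close> and \<open>x\<^sup>2 (w (q + 1) - 1)\<close>. They
  have opposite signs as soon as \<open>1 / w\<close> lies strictly between \<open>p + 1\<close> and \<open>q + 1\<close>, and then the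
  trace is a polynomial in \<open>x\<^sup>2\<close> of degree two with negative leading coefficient.
\<close>
lemma mat_trace_geom_mat_negative:
  fixes p q :: real
  assumes "p > 1" "q > 1" "p \<noteq> q"
  shows "\<exists>x z. mat_trace (geom_mat x z p * transpose_mat (geom_mat x z q)) < 0"
proof -
  \<comment> \<open>The midpoint of \<open>p + 1\<close> and \<open>q + 1\<close> for \<open>1 / w\<close> makes the corner factors exactly opposite.\<close>
  define w where "w = 2 / (p + q + 2)"
  define c where "c = (p - 1) * (q - 1) * ((p - q) / (p + q + 2))\<^sup>2"
  have "c > 0" using assms by (simp add: c_def)
  moreover have "0 \<le> (p - 1) * (q - 1) * (1 + p * q)" "0 \<le> 1 + p * q + p\<^sup>2 * q\<^sup>2"
    using assms by (auto intro!: mult_nonneg_nonneg add_nonneg_nonneg)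
  ultimately obtain x where x: "1 + p * q + p\<^sup>2 * q\<^sup>2 + (p - 1) * (q - 1) * (1 + p * q) * x\<^sup>2 - c * (x\<^sup>2)\<^sup>2 < 0"
    using quadratic_dominates_at_square by blast
  define r where "r = (p - q) / (p + q + 2)"
  have "w * (p + 1) - 1 = r" "w * (q + 1) - 1 = - r"
    using assms by (simp_all add: w_def r_def field_simps)
  moreover have "w * x\<^sup>2 * (s + 1) - x\<^sup>2 = x\<^sup>2 * (w * (s + 1) - 1)" for s
    by (simp add: algebra_simps)
  ultimately have "w * x\<^sup>2 * (p + 1) - x\<^sup>2 = x\<^sup>2 * r" "w * x\<^sup>2 * (q + 1) - x\<^sup>2 = x\<^sup>2 * - r"
    by simp_all
  then have "mat_trace (geom_mat x (w * x\<^sup>2) p * transpose_mat (geom_mat x (w * x\<^sup>2) q)) =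
    1 + p * q + p\<^sup>2 * q\<^sup>2 + (p - 1) * (q - 1) * (1 + p * q) * x\<^sup>2 - c * (x\<^sup>2)\<^sup>2"
    by (simp only: mat_trace_geom_mat c_def flip: r_def) (simp add: power2_eq_square)
  with x show ?thesis by metis
qed

theorem theorem1p9:
  fixes j k :: nat
  assumes "j > 0" and "k > 0" and "j \<noteq> k"
  shows "\<exists>(n::nat) (T::real mat). T \<in> carrier_mat n n \<and>
           quasi_positive (map_mat complex_of_real T) \<and>
           mat_trace (T ^\<^sub>m k * (transpose_mat T) ^\<^sub>m j) < 0"
proof -
  obtain x z :: real
    where "mat_trace (geom_mat x z (2 ^ k) * transpose_mat (geom_mat x z (2 ^ j))) < 0"
    using mat_trace_geom_mat_negative[of "2 ^ k" "2 ^ j"] assms by auto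
  then have "mat_trace (geom_mat x z 2 ^\<^sub>m k * transpose_mat (geom_mat x z 2) ^\<^sub>m j) < 0"
    by (simp add: geom_mat_pow transpose_geom_mat_pow)
  then show ?thesis
    using geom_mat_carrier geom_mat_quasi_positive[of 2] by (metis zero_less_numeral)
qed

end
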